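(* Let $\kappa$ be continuous, let $\eta\in GS$ be continuous, and let $\psi$ be differentiable, not identically zero, with $\psi(0)\neq0$. Suppose $K$ is a continuous, non-constant solution of $$K(x+y\eta(x))-K(y)=\psi(y)\kappa(x)\qquad(x,y\in\mathbb{R}),$$ and let $f(x):=\eta(x)/\psi(x)$. Then: (i) $K(x)\equiv\kappa'(0)\tau_f(x)+K(0)$; (ii) $\kappa(x)\equiv aK(x)+b$ for some $a,b\in\mathbb{R}$; (iii) provided $\psi(0)=1$, $f:(\mathbb{R},\circ_\eta)\to(\mathbb{R},\cdot)$ is a homomorphism; equivalently, $f$ solves Chudziak's functional equation $f(x+y\eta(x))=f(x)f(y)$. So $\psi(x)\equiv\eta(x)/f(x)$, where $f$ satisfies this equation.
   Context: $GS$ denotes the family of functions $\eta(x)=1+\rho x$ with $\rho\ge0$. $x\circ_\eta y:=x+y\eta(x)$. $\tau_f(x):=\int_0^x du/f(u)$, with $1/f$ meaning $\psi/\eta$. $f$ is called the relative flow-velocity. Chudziak's equation in general reads $f(x+yg(x))=f(x)\circ f(y)$ with $f$ valued in a semigroup; here $g=\eta$ and the semigroup operation is multiplication. Identities involving division by $\eta(x)$ are read at points where $\eta(x)\neq0$ (in particular they are meaningful on $[0,\infty)$). *)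

theory Defs
  imports "HOL-Analysis.Analysis" "HOL-Algebra.Group"
begin

definition GS :: "(real \<Rightarrow> real) set" where
  "GS = {\<eta>. \<exists>\<rho>\<ge>0. \<forall>x. \<eta> x = 1 + \<rho> * x}"

definition circ :: "(real \<Rightarrow> real) \<Rightarrow> real \<Rightarrow> real \<Rightarrow> real" where
  "circ \<eta> x y = x + y * \<eta> x"

definition circ_monoid :: "(real \<Rightarrow> real) \<Rightarrow> real monoid" where
  "circ_monoid \<eta> = \<lparr>carrier = UNIV, mult = circ \<eta>, one = 0\<rparr>"

definition times_monoid :: "real monoid" where
  "times_monoid = \<lparr>carrier = UNIV, mult = (*), one = 1\<rparr>"

(* The integral is oriented, so x < 0 is allowed.  For f = \<eta> / \<psi> the conventions
   of HOL give 1 / f = \<psi> / \<eta> everywhere, with value 0 at a zero of \<eta>. *)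
definition tau_integrable :: "(real \<Rightarrow> real) \<Rightarrow> real \<Rightarrow> bool" where
  "tau_integrable f x \<longleftrightarrow>
     interval_lebesgue_integrable lborel (ereal 0) (ereal x) (\<lambda>u. 1 / f u)"

definition tau :: "(real \<Rightarrow> real) \<Rightarrow> real \<Rightarrow> real" where
  "tau f x = (LBINT u=ereal 0..ereal x. 1 / f u)"

end

theory Submission
  imports Defs
begin

text \<open>
  Since \<open>\<eta> x = 1 + \<rho> * x\<close>, the operation \<open>x + y * \<eta> x = x + y + \<rho> * x * y\<close> is commutative and
  associative, and \<open>\<eta>\<close> turns it into multiplication. Putting \<open>y = 0\<close> expresses \<open>\<kappa>\<close> as
  \<open>(K - K 0) / \<psi> 0\<close>, which is the affine relation; it also turns the equation into
  \<open>H (x + y * \<eta> x) = H y + \<phi> y * H x\<close> for \<open>H = K - K 0\<close> and \<open>\<phi> = \<psi> / \<psi> 0\<close>, an equation of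
  Goldie type in which \<open>\<phi>\<close> is forced to be multiplicative: evaluate \<open>H\<close> at a triple product
  in the two possible ways and compare (\<open>goldie_factor_multiplicative\<close>). As \<open>\<eta>\<close> is
  multiplicative as well, so is \<open>\<eta> / \<phi>\<close>, which is \<open>f\<close> when \<open>\<psi> 0 = 1\<close>: this is the
  homomorphism property.

  For the integral formula, \<open>H\<close> is only continuous at first. Integrating the equation in
  one variable writes \<open>H\<close> through a primitive of \<open>H\<close> and through \<open>\<phi>\<close>, so that \<open>H\<close> inherits
  differentiability (\<open>goldie_solution_differentiable\<close>). Differentiating the equation at the
  neutral element then gives \<open>H' = H' 0 * \<phi> / \<eta>\<close> away from the zero of \<open>\<eta>\<close>
  (\<open>goldie_solution_derivative\<close>). When \<open>\<rho> > 0\<close> that zero \<open>-1/\<rho>\<close> is a genuine obstacle to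
  integrating up: it is absorbing for the operation, which makes \<open>\<phi>\<close> vanish there as well
  (\<open>goldie_factor_zero\<close>), and differentiability of \<open>\<psi>\<close> then lets the quotient \<open>\<psi> / \<eta>\<close>
  extend continuously (\<open>quotient_by_affine_extends\<close>). A version of the fundamental
  theorem of calculus that tolerates finitely many exceptional points
  (\<open>interval_FTC_finite_exceptions\<close>) finishes the proof.
\<close>

section \<open>The algebra of the Goldie equation\<close>

text \<open>
  Both bracketings of the product of \<open>w\<close>, \<open>y\<close> and \<open>z\<close> expand \<open>H\<close> there in terms of the
  factors. After cancelling, one has \<open>\<phi>\<close> of the product of \<open>y\<close> and \<open>z\<close>, times \<open>H w\<close>, and the
  other has \<open>\<phi> y * \<phi> z * H w\<close>.
\<close>
lemma goldie_factor_multiplicative: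
  fixes H \<phi> :: "real \<Rightarrow> real" and \<rho> :: real
  assumes H_eq: "\<And>x y. H (x + y * (1 + \<rho> * x)) = H y + \<phi> y * H x"
    and nz: "H w \<noteq> 0"
  shows "\<phi> (y + z * (1 + \<rho> * y)) = \<phi> y * \<phi> z"
proof -
  let ?yz = "y + z * (1 + \<rho> * y)"
  let ?wy = "w + y * (1 + \<rho> * w)"
  have "w + ?yz * (1 + \<rho> * w) = ?wy + z * (1 + \<rho> * ?wy)"
    by (simp add: algebra_simps)
  then have "H ?yz + \<phi> ?yz * H w = H z + \<phi> z * H ?wy"
    by (metis H_eq)
  then have "H z + \<phi> z * H y + \<phi> ?yz * H w = H z + \<phi> z * (H y + \<phi> y * H w)"
    by (simp only: H_eq)
  then have "\<phi> ?yz * H w = (\<phi> y * \<phi> z) * H w"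
    by (simp add: algebra_simps)
  with nz show ?thesis by simp
qed

text \<open>Off the zero of \<open>\<eta>\<close>, the point \<open>- x / \<eta> x\<close> is an inverse of \<open>x\<close>.\<close>
lemma multiplicative_nonzero:
  fixes \<phi> :: "real \<Rightarrow> real" and \<rho> :: real
  assumes mult: "\<And>y z. \<phi> (y + z * (1 + \<rho> * y)) = \<phi> y * \<phi> z"
    and one: "\<phi> 0 = 1" and unit: "1 + \<rho> * x \<noteq> 0"
  shows "\<phi> x \<noteq> 0"
proof
  assume "\<phi> x = 0"
  moreover have "x + (- x / (1 + \<rho> * x)) * (1 + \<rho> * x) = 0"
    using unit by simp
  ultimately show False
    using mult[of x "- x / (1 + \<rho> * x)"] one by simp
qed

text \<open>A zero \<open>x\<close> of \<open>\<eta>\<close> absorbs every \<open>w\<close>, so that \<open>H x = H x + \<phi> x * H w\<close>.\<close>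
lemma goldie_factor_zero:
  fixes H \<phi> :: "real \<Rightarrow> real" and \<rho> :: real
  assumes H_eq: "\<And>x y. H (x + y * (1 + \<rho> * x)) = H y + \<phi> y * H x"
    and nz: "H w \<noteq> 0" and zero: "1 + \<rho> * x = 0"
  shows "\<phi> x = 0"
proof -
  have "w + x * (1 + \<rho> * w) = x + w * (1 + \<rho> * x)"
    by (simp add: algebra_simps)
  also have "\<dots> = x"
    using zero by simp
  finally show ?thesis
    using H_eq[of w x] nz by simp
qed

section \<open>Regularity of the solutions\<close>

lemma continuous_has_primitive:
  fixes g :: "real \<Rightarrow> real"
  assumes "continuous_on UNIV g"
  obtains P where "\<And>x. (P has_real_derivative g x) (at x)"
proof -
  have "\<exists>F. \<forall>x::real. - \<infinity> < ereal x \<longrightarrow> ereal x < \<infinity> \<longrightarrow> (F has_vector_derivative g x) (at x)"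
    using assms by (intro einterval_antiderivative) (auto simp: continuous_on_eq_continuous_at)
  then show thesis
    using that by (auto simp: has_real_derivative_iff_has_vector_derivative)
qed

text \<open>
  With a primitive \<open>P\<close> of \<open>H\<close>, integrating \<open>H (y + x * \<eta> y) = H y + \<phi> y * H x\<close> over
  \<open>0 \<le> x \<le> 1\<close> gives \<open>(P (y + \<eta> y) - P y) / \<eta> y = H y + \<phi> y * (P 1 - P 0)\<close>, in which every
  term other than \<open>H y\<close> is differentiable in \<open>y\<close>.
\<close>
lemma goldie_solution_differentiable:
  fixes H \<phi> :: "real \<Rightarrow> real" and \<rho> :: real
  assumes H_eq: "\<And>x y. H (x + y * (1 + \<rho> * x)) = H y + \<phi> y * H x"
    and H_cont: "continuous_on UNIV H" and \<phi>_diff: "\<And>x. \<phi> differentiable (at x)"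
    and unit: "1 + \<rho> * y \<noteq> 0"
  shows "H differentiable (at y)"
proof -
  obtain P where P: "\<And>x. (P has_real_derivative H x) (at x)"
    using continuous_has_primitive[OF H_cont] by blast
  have H_formula: "H u = (P (u + (1 + \<rho> * u)) - P u) / (1 + \<rho> * u) - \<phi> u * (P 1 - P 0)"
    if u: "1 + \<rho> * u \<noteq> 0" for u
  proof -
    let ?e = "1 + \<rho> * u"
    let ?Q = "\<lambda>x. P (u + x * ?e) - ?e * (x * H u + \<phi> u * P x)"
    have "(?Q has_real_derivative 0) (at x)" for x
    proof -
      have "(?Q has_real_derivative H (u + x * ?e) * ?e - ?e * (H u + \<phi> u * H x)) (at x)"
        by (auto intro!: derivative_eq_intros DERIV_chain2[OF P] P)
      moreover have "u + x * ?e = x + u * (1 + \<rho> * x)"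
        by (simp add: algebra_simps)
      then have "H (u + x * ?e) = H u + \<phi> u * H x"
        by (simp only: H_eq)
      ultimately show ?thesis by simp
    qed
    then have "?Q 1 = ?Q 0"
      by (intro DERIV_isconst_all) auto
    then have "P (u + ?e) - P u = ?e * (H u + \<phi> u * (P 1 - P 0))"
      by (simp add: algebra_simps)
    then show ?thesis
      using u by simp
  qed
  define R where "R = (\<lambda>u. (P (u + (1 + \<rho> * u)) - P u) / (1 + \<rho> * u) - \<phi> u * (P 1 - P 0))"
  obtain d where d: "(\<phi> has_real_derivative d) (at y)"
    using \<phi>_diff by (auto simp: real_differentiable_def)
  have "\<exists>D. (R has_real_derivative D) (at y)"
    unfolding R_def
    by (rule exI, (rule derivative_eq_intros DERIV_chain2[OF P] P d refl unit)+)
  moreover have "eventually (\<lambda>u. H u = R u) (nhds y)"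
  proof -
    have "isCont (\<lambda>u. 1 + \<rho> * u) y"
      by (intro continuous_intros)
    then have "eventually (\<lambda>u. 1 + \<rho> * u \<noteq> 0) (at y)"
      using unit by (auto simp: isCont_def intro: tendsto_imp_eventually_ne)
    then have "eventually (\<lambda>u. 1 + \<rho> * u \<noteq> 0) (nhds y)"
      using unit by (simp add: eventually_nhds_conv_at)
    then show ?thesis
      by eventually_elim (simp add: H_formula R_def)
  qed
  ultimately show ?thesis
    unfolding real_differentiable_def using DERIV_cong_ev[OF refl _ refl] by blast
qed

text \<open>Both sides of \<open>H (y + x * \<eta> y) = H y + \<phi> y * H x\<close> are differentiated in \<open>x\<close> at \<open>0\<close>.\<close>
lemma goldie_solution_derivative:
  fixes H \<phi> :: "real \<Rightarrow> real" and \<rho> :: real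
  assumes H_eq: "\<And>x y. H (x + y * (1 + \<rho> * x)) = H y + \<phi> y * H x"
    and H_cont: "continuous_on UNIV H" and \<phi>_diff: "\<And>x. \<phi> differentiable (at x)"
    and unit: "1 + \<rho> * y \<noteq> 0"
  shows "(H has_real_derivative deriv H 0 * (\<phi> y / (1 + \<rho> * y))) (at y)"
proof -
  let ?e = "1 + \<rho> * y"
  have D: "(H has_real_derivative deriv H u) (at u)" if "1 + \<rho> * u \<noteq> 0" for u
    using goldie_solution_differentiable[OF H_eq H_cont \<phi>_diff that]
    by (metis real_differentiable_def DERIV_imp_deriv)
  have "((\<lambda>x. H (y + x * ?e)) has_real_derivative deriv H y * ?e) (at 0)"
    by (rule DERIV_chain2[where x = 0]) (auto intro!: derivative_eq_intros D unit)
  moreover have "(\<lambda>x. H (y + x * ?e)) = (\<lambda>x. H y + \<phi> y * H x)"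
  proof
    fix x
    have "y + x * ?e = x + y * (1 + \<rho> * x)"
      by (simp add: algebra_simps)
    then show "H (y + x * ?e) = H y + \<phi> y * H x"
      by (simp only: H_eq)
  qed
  moreover have "((\<lambda>x. H y + \<phi> y * H x) has_real_derivative \<phi> y * deriv H 0) (at 0)"
    by (auto intro!: derivative_eq_intros D)
  ultimately have "deriv H y * ?e = \<phi> y * deriv H 0"
    using DERIV_unique by metis
  then have "deriv H y = deriv H 0 * (\<phi> y / ?e)"
    using unit by (simp add: field_simps)
  with D[OF unit] show ?thesis by simp
qed

section \<open>Integration across exceptional points\<close>

text \<open>
  The value of \<open>p\<close> on the finite set \<open>S\<close> affects neither integrability nor the integral, so
  \<open>p\<close> may be replaced by \<open>g\<close>; and \<open>F\<close> differs from \<open>c\<close> times a primitive of \<open>g\<close> by a continuous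
  function with derivative \<open>0\<close> off \<open>S\<close>, that is, by a constant.
\<close>
lemma interval_FTC_finite_exceptions:
  fixes F g p :: "real \<Rightarrow> real" and a b c :: real
  assumes S: "finite S" and g_cont: "continuous_on UNIV g"
    and p_meas: "p \<in> borel_measurable borel"
    and p_eq: "\<And>u. u \<notin> S \<Longrightarrow> p u = g u"
    and F_cont: "continuous_on UNIV F"
    and F_deriv: "\<And>u. u \<notin> S \<Longrightarrow> (F has_real_derivative c * p u) (at u)"
  shows "interval_lebesgue_integrable lborel (ereal a) (ereal b) p"
    and "F b - F a = c * (LBINT u=ereal a..ereal b. p u)"
proof -
  have g_meas: "g \<in> borel_measurable borel"
    using g_cont by (rule borel_measurable_continuous_onI)
  have "S \<in> null_sets lborel"
    using S by (rule finite_imp_null_set_lborel)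
  then have "AE u in lborel. u \<notin> S"
    by (rule AE_not_in)
  then have ae: "AE u \<in> einterval (min (ereal a) (ereal b)) (max (ereal a) (ereal b)) in lborel. p u = g u"
    by eventually_elim (simp add: p_eq)
  have "interval_lebesgue_integrable lborel (ereal a) (ereal b) g"
    using g_cont by (intro interval_integrable_isCont) (simp add: continuous_on_eq_continuous_at)
  then show "interval_lebesgue_integrable lborel (ereal a) (ereal b) p"
    using interval_lebesgue_integrable_cong_AE[OF _ _ ae] p_meas g_meas by simp
  obtain P where P: "\<And>x. (P has_real_derivative g x) (at x)"
    using continuous_has_primitive[OF g_cont] by blast
  have P_cont: "continuous_on UNIV P"
    using P by (meson DERIV_isCont continuous_at_imp_continuous_on)
  have "\<forall>u\<in>UNIV - S. ((\<lambda>x. F x - c * P x) has_real_derivative 0) (at u)"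
  proof
    fix u assume u: "u \<in> UNIV - S"
    then have "(F has_real_derivative c * g u) (at u)"
      using F_deriv[of u] p_eq[of u] by simp
    then show "((\<lambda>x. F x - c * P x) has_real_derivative 0) (at u)"
      by (auto intro!: derivative_eq_intros P)
  qed
  moreover have "continuous_on UNIV (\<lambda>x. F x - c * P x)"
    by (intro continuous_intros F_cont P_cont)
  ultimately obtain k where k: "\<And>x. x \<in> UNIV \<Longrightarrow> F x - c * P x = k"
    using DERIV_zero_connected_constant[of UNIV S "\<lambda>x. F x - c * P x"] S by blast
  have "F b - F a = c * (P b - P a)"
    using k[of a] k[of b] by (simp add: algebra_simps)
  also have "P b - P a = (LBINT u=ereal a..ereal b. g u)"
    using P g_cont
    by (intro interval_integral_FTC_finite[symmetric])
       (auto intro: continuous_on_subset has_vector_derivative_at_within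
             simp: has_real_derivative_iff_has_vector_derivative)
  also have "\<dots> = (LBINT u=ereal a..ereal b. p u)"
    using interval_integral_cong_AE[OF p_meas g_meas ae] by simp
  finally show "F b - F a = c * (LBINT u=ereal a..ereal b. p u)" .
qed

text \<open>
  At the zero of the denominator the quotient is, up to the factor \<open>\<rho>\<close>, a difference
  quotient of \<open>\<psi>\<close>, and extends by the derivative.
\<close>
lemma quotient_by_affine_extends:
  fixes \<psi> :: "real \<Rightarrow> real" and \<rho> :: real
  assumes \<psi>_diff: "\<And>x. \<psi> differentiable (at x)"
    and zero: "\<And>x. 1 + \<rho> * x = 0 \<Longrightarrow> \<psi> x = 0"
  obtains g where "continuous_on UNIV g" "\<And>x. 1 + \<rho> * x \<noteq> 0 \<Longrightarrow> \<psi> x / (1 + \<rho> * x) = g x"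
proof (cases "\<rho> = 0")
  case True
  have "continuous_on UNIV \<psi>"
    using \<psi>_diff by (simp add: continuous_on_eq_continuous_at differentiable_imp_continuous_within)
  then show thesis
    using that[of \<psi>] True by simp
next
  case False
  define x0 where "x0 = - 1 / \<rho>"
  have affine: "1 + \<rho> * x = \<rho> * (x - x0)" for x
    using False by (simp add: x0_def field_simps)
  obtain l where "(\<psi> has_real_derivative l) (at x0)"
    using \<psi>_diff by (auto simp: real_differentiable_def)
  then obtain q where q: "\<And>z. \<psi> z - \<psi> x0 = q z * (z - x0)" and q0: "isCont q x0"
    by (auto simp: CARAT_DERIV)
  have \<psi>_q: "\<psi> z = q z * (z - x0)" for z
    using q[of z] zero[of x0] affine[of x0] by simp
  have "isCont q x" for x
  proof (cases "x = x0")
    case False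
    have "eventually (\<lambda>z. z \<noteq> x0) (nhds x)"
      using False t1_space_nhds by blast
    then have "eventually (\<lambda>z. \<psi> z / (z - x0) = q z) (nhds x)"
      by eventually_elim (simp add: \<psi>_q)
    moreover have "isCont (\<lambda>z. \<psi> z / (z - x0)) x"
      using False \<psi>_diff[of x] by (intro continuous_intros differentiable_imp_continuous_within) auto
    ultimately show ?thesis
      using isCont_cong[of "\<lambda>z. \<psi> z / (z - x0)" q x] by simp
  qed (simp add: q0)
  then have "continuous_on UNIV (\<lambda>x. q x / \<rho>)"
    using False by (intro continuous_intros continuous_at_imp_continuous_on) auto
  moreover have "\<psi> x / (1 + \<rho> * x) = q x / \<rho>" if "1 + \<rho> * x \<noteq> 0" for x
    using that False by (auto simp: affine \<psi>_q)
  ultimately show thesis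
    using that by blast
qed

section \<open>Solutions of the generalized equation\<close>

theorem corollary1:
  fixes K \<kappa> \<psi> \<eta> f :: "real \<Rightarrow> real"
  assumes kappa_cont: "continuous_on UNIV \<kappa>"
    and eta_GS: "\<eta> \<in> GS"
    and eta_cont: "continuous_on UNIV \<eta>"
    and psi_diff: "\<psi> differentiable_on UNIV"
    and psi_not_zero: "\<exists>x. \<psi> x \<noteq> 0"
    and psi_0: "\<psi> 0 \<noteq> 0"
    and K_cont: "continuous_on UNIV K"
    and K_nonconst: "\<not> K constant_on UNIV"
    and K_eq: "\<And>x y. K (x + y * \<eta> x) - K y = \<psi> y * \<kappa> x"
    and f_def: "\<And>x. f x = \<eta> x / \<psi> x"
  shows "(\<forall>x. \<eta> x \<noteq> 0 \<longrightarrow> \<psi> x \<noteq> 0) \<and>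
    (\<kappa> differentiable (at 0) \<and>
      (\<forall>x. tau_integrable f x \<and> K x = deriv \<kappa> 0 * tau f x + K 0)) \<and>
    (\<exists>a b. \<forall>x. \<kappa> x = a * K x + b) \<and>
    (\<psi> 0 = 1 \<longrightarrow>
      f \<in> hom (circ_monoid \<eta>) times_monoid \<and>
      (\<forall>x y. f (x + y * \<eta> x) = f x * f y) \<and>
      (\<forall>x. \<psi> x = \<eta> x / f x))"
proof -
  obtain \<rho> where \<eta>: "\<And>x. \<eta> x = 1 + \<rho> * x"
    using eta_GS by (auto simp: GS_def)
  define H where "H = (\<lambda>x. K x - K 0)"
  define \<phi> where "\<phi> = (\<lambda>x. \<psi> x / \<psi> 0)"
  have \<kappa>: "\<kappa> x = H x / \<psi> 0" for x
    using K_eq[of x 0] psi_0 by (simp add: H_def field_simps)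
  have H_eq: "H (x + y * (1 + \<rho> * x)) = H y + \<phi> y * H x" for x y
    using K_eq[of x y] by (simp add: H_def \<phi>_def \<eta> \<kappa>)
  have "\<exists>w. H w \<noteq> 0"
    using K_nonconst by (auto simp: H_def constant_on_def)
  then obtain w where w: "H w \<noteq> 0" ..
  have H_cont: "continuous_on UNIV H"
    unfolding H_def by (intro continuous_intros K_cont)
  have \<psi>_diff: "\<psi> differentiable (at x)" for x
    using psi_diff by (simp add: differentiable_on_def)
  then have \<phi>_diff: "\<phi> differentiable (at x)" for x
    unfolding \<phi>_def using psi_0 by (intro differentiable_divide) auto
  note mult = goldie_factor_multiplicative[OF H_eq w]
  have \<psi>_nz: "\<psi> x \<noteq> 0" if "\<eta> x \<noteq> 0" for x
    using multiplicative_nonzero[OF mult, of x] that psi_0 by (simp add: \<phi>_def \<eta>)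
  have \<psi>_zero: "\<psi> x = 0" if "1 + \<rho> * x = 0" for x
    using goldie_factor_zero[OF H_eq w that] psi_0 by (simp add: \<phi>_def)

  have H_deriv: "(H has_real_derivative deriv H 0 * (\<phi> u / (1 + \<rho> * u))) (at u)"
    if "1 + \<rho> * u \<noteq> 0" for u
    by (rule goldie_solution_derivative[OF H_eq H_cont \<phi>_diff that])
  have "\<kappa> = (\<lambda>x. H x / \<psi> 0)"
    by (rule ext) (rule \<kappa>)
  moreover have "((\<lambda>x. H x / \<psi> 0) has_real_derivative deriv H 0 / \<psi> 0) (at 0)"
    using H_deriv[of 0] psi_0 by (intro DERIV_cdivide) (simp add: \<phi>_def)
  ultimately have \<kappa>_deriv: "(\<kappa> has_real_derivative deriv H 0 / \<psi> 0) (at 0)"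
    by simp
  then have \<kappa>_diff: "\<kappa> differentiable (at 0)" and \<kappa>'0: "deriv \<kappa> 0 = deriv H 0 / \<psi> 0"
    by (auto simp: real_differentiable_def DERIV_imp_deriv)

  obtain g where g_cont: "continuous_on UNIV g"
    and g: "\<And>x. 1 + \<rho> * x \<noteq> 0 \<Longrightarrow> \<psi> x / (1 + \<rho> * x) = g x"
    using quotient_by_affine_extends[OF \<psi>_diff \<psi>_zero] by blast
  let ?S = "{x. 1 + \<rho> * x = 0}"
  have inv_f: "1 / f u = \<psi> u / (1 + \<rho> * u)" for u
    by (simp add: f_def \<eta>)
  have "?S \<subseteq> {- 1 / \<rho>}"
  proof
    fix x assume x: "x \<in> ?S"
    then have "\<rho> \<noteq> 0" by auto
    with x show "x \<in> {- 1 / \<rho>}"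
      by (simp add: field_simps)
  qed
  then have S: "finite ?S"
    by (rule finite_subset) simp
  have "continuous_on UNIV \<psi>"
    using psi_diff by (rule differentiable_imp_continuous_on)
  then have "\<psi> \<in> borel_measurable borel"
    by (rule borel_measurable_continuous_onI)
  then have meas: "(\<lambda>u. 1 / f u) \<in> borel_measurable borel"
    unfolding inv_f by measurable
  have "(K has_real_derivative deriv \<kappa> 0 * (1 / f u)) (at u)" if u: "u \<notin> ?S" for u
  proof -
    have "((\<lambda>x. H x + K 0) has_real_derivative deriv H 0 * (\<phi> u / (1 + \<rho> * u)) + 0) (at u)"
      using u by (intro DERIV_add DERIV_const H_deriv) simp
    then show ?thesis
      by (simp add: H_def \<phi>_def inv_f \<kappa>'0)
  qed
  note FTC = interval_FTC_finite_exceptions[OF S g_cont meas _ K_cont this]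
  have integral_formula: "tau_integrable f x \<and> K x = deriv \<kappa> 0 * tau f x + K 0" for x
    using FTC(1)[of 0 x] FTC(2)[where a = 0 and b = x]
    by (simp add: tau_integrable_def tau_def inv_f g)

  have affine: "\<exists>a b. \<forall>x. \<kappa> x = a * K x + b"
    by (rule exI[of _ "1 / \<psi> 0"], rule exI[of _ "- K 0 / \<psi> 0"])
       (simp add: \<kappa> H_def diff_divide_distrib)

  have hom: "f \<in> hom (circ_monoid \<eta>) times_monoid \<and>
      (\<forall>x y. f (x + y * \<eta> x) = f x * f y) \<and> (\<forall>x. \<psi> x = \<eta> x / f x)" if one: "\<psi> 0 = 1"
  proof -
    have "\<phi> = \<psi>"
      by (simp add: \<phi>_def one)
    with mult have \<psi>_mult: "\<psi> (x + y * \<eta> x) = \<psi> x * \<psi> y" for x y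
      by (simp add: \<eta>)
    have \<eta>_mult: "\<eta> (x + y * \<eta> x) = \<eta> x * \<eta> y" for x y
      by (simp add: \<eta> algebra_simps)
    have f_mult: "f (x + y * \<eta> x) = f x * f y" for x y
      by (simp add: f_def \<psi>_mult \<eta>_mult)
    \<comment> \<open>At a zero of \<open>\<eta>\<close> the right-hand side is \<open>0 / 0 = 0\<close>, which is the value of \<open>\<psi>\<close> there.\<close>
    have "\<psi> x = \<eta> x / f x" for x
      using \<psi>_zero[of x] by (cases "\<eta> x = 0") (simp_all add: f_def \<eta>)
    with f_mult show ?thesis
      by (auto simp: hom_def circ_monoid_def times_monoid_def circ_def)
  qed
  from \<psi>_nz \<kappa>_diff integral_formula affine hom show ?thesis
    by blast
qed

end
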